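(* Let $(A,\mu,\Delta,\alpha)$ be an $\epsilon$-Hom-bialgebra. Then $$A_{HLie}=(A,[-,-],\delta,\alpha)$$ is a Hom-Lie bialgebra if and only if the balanceator $B$ of $A$ is symmetric, where $[-,-]=\mu\circ(Id-\tau)$ and $\delta=(Id-\tau)\circ\Delta$.
   Context: Throughout, $\mathbf{k}$ is a fixed field of characteristic $0$; vector spaces, linear maps and tensor products are over $\mathbf{k}$. $\tau$ denotes the twist $\tau(x\otimes y)=y\otimes x$; $\mu(a,b)$ is also written $ab$. An $\epsilon$-Hom-bialgebra $(A,\mu,\Delta,\alpha)$ is a $\mathbf{k}$-vector space $A$ with linear maps $\mu\colon A^{\otimes 2}\to A$, $\Delta\colon A\to A^{\otimes 2}$, $\alpha\colon A\to A$ such that: $\alpha\circ\mu=\mu\circ\alpha^{\otimes 2}$; $\mu\circ(\alpha\otimes\mu)=\mu\circ(\mu\otimes\alpha)$; $\alpha^{\otimes 2}\circ\Delta=\Delta\circ\alpha$; $(\alpha\otimes\Delta)\circ\Delta=(\Delta\otimes\alpha)\circ\Delta$; and $\Delta\circ\mu=(\mu\otimes\alpha)\circ(\alpha\otimes\Delta)+(\alpha\otimes\mu)\circ(\Delta\otimes\alpha)$. For $a\in A$ and $b=\sum b_1\otimes b_2\in A^{\otimes 2}$, set $[a,b]_\bullet=\sum\alpha(a)b_1\otimes\alpha(b_2)-\alpha(b_1)\otimes b_2\alpha(a)$. With $\Delta^{op}=\tau\circ\Delta$, the balanceator of $A$ is the map $B\colon A^{\otimes 2}\to A^{\otimes 2}$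 given by $$B(x,y)=[x,\Delta^{op}(y)]_\bullet+\tau([y,\Delta^{op}(x)]_\bullet).$$ It is symmetric if $B(x,y)=B(y,x)$ for all $x,y\in A$. Let $\sigma$ denote the cyclic permutation $(1\,2\,3)$ acting on $3$-fold tensors. A Hom-Lie algebra $(L,[-,-],\alpha)$ is a vector space $L$ with a linear map $\alpha\colon L\to L$ and an anti-symmetric bilinear bracket such that $\alpha\circ[-,-]=[-,-]\circ\alpha^{\otimes 2}$ and $[-,-]\circ([-,-]\otimes\alpha)\circ(Id+\sigma+\sigma^2)=0$, i.e. $[[x,y],\alpha(z)]+[[z,x],\alpha(y)]+[[y,z],\alpha(x)]=0$. A Hom-Lie coalgebra $(L,\delta,\alpha)$ is a vector space $L$ with linear maps $\alpha\colon L\to L$ and $\delta\colon L\to L^{\otimes 2}$ such that $\delta\circ\alpha=\alpha^{\otimes 2}\circ\delta$, $\tau\circ\delta=-\delta$, and $(Id+\sigma+\sigma^2)\circ(\alpha\otimes\delta)\circ\delta=0$. For $x$ in a Hom-Lie algebra $L$, set $\mathrm{ad}_x(y_1\otimes y_2)=[x,y_1]\otimes\alpha(y_2)+\alpha(y_1)\otimes[x,y_2]$ on $L^{\otimes 2}$ (extended linearly). A Hom-Lie bialgebra $(L,[-,-],\delta,\alpha)$ is a quadruple such that $(L,[-,-],\alpha)$ is a Hom-Lie algebra, $(L,\delta,\alpha)$ is a Hom-Lie coalgebra, and $\delta([x,y])=\mathrm{ad}_{\alpha(x)}(\delta(y))-\mathrm{ad}_{\alpha(y)}(\delta(x))$ for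 all $x,y\in L$. *)

theory Defs
  imports Complex_Main "HOL-Library.Poly_Mapping" "HOL-Library.Function_Algebras"
begin

section \<open>Tensor products of vector spaces\<close>

text \<open>
  A vector space over the field \<open>'k\<close> is a type with a scalar multiplication satisfying
  \<^locale>\<open>vector_space\<close>.  A tensor product of vector spaces on \<open>'v\<close> and \<open>'w\<close> cannot be a type
  constructed from \<open>'v\<close>, \<open>'w\<close> and \<open>'k\<close>, since it depends on the scalar multiplications.  Hence a
  tensor product is a vector space on some further type \<open>'t\<close>, together with a map
  \<open>(v, w) \<mapsto> v \<otimes> w\<close> exhibiting it as the quotient of the free vector space on
  \<open>'v \<times> 'w\<close> by the subspace spanned by the bilinearity relations.
\<close>

record ('k, 'v, 'w, 't) tensor_space =
  tscale :: "'k \<Rightarrow> 't \<Rightarrow> 't"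
  tens :: "'v \<Rightarrow> 'w \<Rightarrow> 't"

definition free_scale :: "'k::field \<Rightarrow> ('x \<Rightarrow>\<^sub>0 'k) \<Rightarrow> ('x \<Rightarrow>\<^sub>0 'k)" where
  "free_scale c f = Poly_Mapping.map ((*) c) f"

definition free_extend :: "('k::field \<Rightarrow> 'u::ab_group_add \<Rightarrow> 'u) \<Rightarrow> ('x \<Rightarrow> 'u) \<Rightarrow> ('x \<Rightarrow>\<^sub>0 'k) \<Rightarrow> 'u" where
  "free_extend s b f = (\<Sum>x\<in>Poly_Mapping.keys f. s (Poly_Mapping.lookup f x) (b x))"

definition tensor_relations ::
  "('k::field \<Rightarrow> 'v::ab_group_add \<Rightarrow> 'v) \<Rightarrow> ('k \<Rightarrow> 'w::ab_group_add \<Rightarrow> 'w) \<Rightarrow> ('v \<times> 'w \<Rightarrow>\<^sub>0 'k) set" where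
  "tensor_relations sV sW =
     {Poly_Mapping.single (v + v', w) 1 - Poly_Mapping.single (v, w) 1 - Poly_Mapping.single (v', w) 1 | v v' w. True} \<union>
     {Poly_Mapping.single (v, w + w') 1 - Poly_Mapping.single (v, w) 1 - Poly_Mapping.single (v, w') 1 | v w w'. True} \<union>
     {Poly_Mapping.single (sV c v, w) 1 - Poly_Mapping.single (v, w) c | c v w. True} \<union>
     {Poly_Mapping.single (v, sW c w) 1 - Poly_Mapping.single (v, w) c | c v w. True}"

locale tensor_product =
  V: vector_space sV + W: vector_space sW + T: vector_space "tscale T"
  for sV :: "'k::field \<Rightarrow> 'v::ab_group_add \<Rightarrow> 'v"
    and sW :: "'k \<Rightarrow> 'w::ab_group_add \<Rightarrow> 'w"
    and T :: "('k, 'v, 'w, 't::ab_group_add) tensor_space" +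
  assumes onto: "surj (free_extend (tscale T) (case_prod (tens T)))"
    and kernel: "{f. free_extend (tscale T) (case_prod (tens T)) f = 0}
                   = module.span free_scale (tensor_relations sV sW)"

definition bilinear_map ::
  "('k::field \<Rightarrow> 'v::ab_group_add \<Rightarrow> 'v) \<Rightarrow> ('k \<Rightarrow> 'w::ab_group_add \<Rightarrow> 'w) \<Rightarrow>
   ('k \<Rightarrow> 'u::ab_group_add \<Rightarrow> 'u) \<Rightarrow> ('v \<Rightarrow> 'w \<Rightarrow> 'u) \<Rightarrow> bool" where
  "bilinear_map sV sW sU f \<longleftrightarrow>
     (\<forall>v. Vector_Spaces.linear sW sU (f v)) \<and> (\<forall>w. Vector_Spaces.linear sV sU (\<lambda>v. f v w))"

text \<open>
  The linear map induced by a bilinear map \<open>f\<close>, i.e. the one with \<open>v \<otimes> w \<mapsto> f v w\<close>;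
  it exists uniquely by \<open>tensor_product.universal_property\<close> below.
\<close>

definition tensor_lift ::
  "('k::field, 'v, 'w, 't::ab_group_add) tensor_space \<Rightarrow> ('k \<Rightarrow> 'u::ab_group_add \<Rightarrow> 'u) \<Rightarrow>
   ('v \<Rightarrow> 'w \<Rightarrow> 'u) \<Rightarrow> 't \<Rightarrow> 'u" where
  "tensor_lift T sU f =
     (THE h. Vector_Spaces.linear (tscale T) sU h \<and> (\<forall>v w. h (tens T v w) = f v w))"

definition tensor_map ::
  "('k::field, 'v, 'w, 't::ab_group_add) tensor_space \<Rightarrow> ('k, 'x, 'y, 'u::ab_group_add) tensor_space \<Rightarrow>
   ('v \<Rightarrow> 'x) \<Rightarrow> ('w \<Rightarrow> 'y) \<Rightarrow> 't \<Rightarrow> 'u" where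
  "tensor_map T U f g = tensor_lift T (tscale U) (\<lambda>v w. tens U (f v) (g w))"

lemma lookup_free_scale [simp]:
  "Poly_Mapping.lookup (free_scale c f) x = c * Poly_Mapping.lookup f x"
  by (simp add: free_scale_def map.rep_eq when_def)

lemma vector_space_free_scale: "vector_space (free_scale :: 'k::field \<Rightarrow> ('x \<Rightarrow>\<^sub>0 'k) \<Rightarrow> _)"
  by standard (auto intro!: poly_mapping_eqI simp: lookup_add algebra_simps)

lemma free_extend_superset:
  assumes "vector_space s" "finite S" "Poly_Mapping.keys f \<subseteq> S"
  shows "free_extend s b f = (\<Sum>x\<in>S. s (Poly_Mapping.lookup f x) (b x))"
proof -
  interpret vector_space s by fact
  show ?thesis
    unfolding free_extend_def
    by (rule sum.mono_neutral_left) (use assms in \<open>auto simp: in_keys_iff\<close>)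
qed

lemma linear_free_extend:
  assumes "vector_space s"
  shows "Vector_Spaces.linear free_scale s (free_extend s b)"
proof -
  interpret vector_space s by fact
  have "free_extend s b (f + g) = free_extend s b f + free_extend s b g" for f g
  proof -
    let ?S = "Poly_Mapping.keys f \<union> Poly_Mapping.keys g"
    have "Poly_Mapping.keys (f + g) \<subseteq> ?S"
      by (rule Poly_Mapping.keys_add)
    then show ?thesis
      by (simp add: free_extend_superset[OF assms, of ?S] lookup_add scale_left_distrib sum.distrib)
  qed
  moreover have "free_extend s b (free_scale c f) = s c (free_extend s b f)" for c f
  proof -
    have "Poly_Mapping.keys (free_scale c f) \<subseteq> Poly_Mapping.keys f"
      by (auto simp: in_keys_iff)
    then show ?thesis
      by (simp add: free_extend_superset[OF assms, of "Poly_Mapping.keys f"] scale_sum_right)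
  qed
  ultimately show ?thesis
    using assms by (simp add: Vector_Spaces.linear_iff vector_space_free_scale)
qed

lemma free_extend_single:
  assumes "vector_space s"
  shows "free_extend s b (Poly_Mapping.single x c) = s c (b x)"
proof -
  interpret vector_space s by fact
  show ?thesis
    by (simp add: free_extend_superset[OF assms, of "{x}"])
qed

lemma linear_comp_free_extend:
  assumes "Vector_Spaces.linear s s' h"
  shows "h (free_extend s b f) = free_extend s' (h \<circ> b) f"
proof -
  interpret Vector_Spaces.linear s s' h by fact
  show ?thesis by (simp add: free_extend_def sum scale)
qed

lemma free_extend_relations:
  assumes "bilinear_map sV sW sU f" "r \<in> module.span free_scale (tensor_relations sV sW)"
  shows "free_extend sU (case_prod f) r = 0"
proof -
  have lin: "Vector_Spaces.linear sW sU (f v)" "Vector_Spaces.linear sV sU (\<lambda>v. f v w)" for v w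
    using assms(1) by (auto simp: bilinear_map_def)
  have U: "vector_space sU"
    using lin(1) by (simp add: Vector_Spaces.linear_iff)
  interpret U: vector_space sU by fact
  interpret E: Vector_Spaces.linear free_scale sU "free_extend sU (case_prod f)"
    using U by (rule linear_free_extend)
  have add: "f v (w + w') = f v w + f v w'" "f (v + v') w = f v w + f v' w"
    and scl: "f v (sW c w) = sU c (f v w)" "f (sV c v) w = sU c (f v w)" for v v' w w' c
    using lin by (auto simp: Vector_Spaces.linear_iff)
  show ?thesis
    by (rule E.eq_0_on_span[OF _ assms(2)])
       (auto simp: tensor_relations_def E.diff free_extend_single[OF U] add scl)
qed

context tensor_product
begin

interpretation E: Vector_Spaces.linear free_scale "tscale T" "free_extend (tscale T) (case_prod (tens T))"
  by (rule linear_free_extend) unfold_locales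

lemma bilinear_tens: "bilinear_map sV sW (tscale T) (tens T)"
proof -
  have rel: "free_extend (tscale T) (case_prod (tens T)) r = 0" if "r \<in> tensor_relations sV sW" for r
    using kernel E.vs1.span_base[OF that] by blast
  have single: "free_extend (tscale T) (case_prod (tens T)) (Poly_Mapping.single (v, w) c)
                  = tscale T c (tens T v w)" for v w c
    by (simp add: free_extend_single T.vector_space_axioms)
  note eval = E.diff single T.scale_one
  have "tens T (v + v') w = tens T v w + tens T v' w" for v v' w
  proof -
    have "Poly_Mapping.single (v + v', w) 1 - Poly_Mapping.single (v, w) 1 - Poly_Mapping.single (v', w) 1
            \<in> tensor_relations sV sW"
      unfolding tensor_relations_def by blast
    from rel[OF this] show ?thesis unfolding eval by (simp add: algebra_simps)
  qed
  moreover have "tens T v (w + w') = tens T v w + tens T v w'" for v w w'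
  proof -
    have "Poly_Mapping.single (v, w + w') 1 - Poly_Mapping.single (v, w) 1 - Poly_Mapping.single (v, w') 1
            \<in> tensor_relations sV sW"
      unfolding tensor_relations_def by blast
    from rel[OF this] show ?thesis unfolding eval by (simp add: algebra_simps)
  qed
  moreover have "tens T (sV c v) w = tscale T c (tens T v w)" for c v w
  proof -
    have "Poly_Mapping.single (sV c v, w) 1 - Poly_Mapping.single (v, w) c \<in> tensor_relations sV sW"
      unfolding tensor_relations_def by blast
    from rel[OF this] show ?thesis unfolding eval by simp
  qed
  moreover have "tens T v (sW c w) = tscale T c (tens T v w)" for c v w
  proof -
    have "Poly_Mapping.single (v, sW c w) 1 - Poly_Mapping.single (v, w) c \<in> tensor_relations sV sW"
      unfolding tensor_relations_def by blast
    from rel[OF this] show ?thesis unfolding eval by simp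
  qed
  ultimately show ?thesis
    by (simp add: bilinear_map_def Vector_Spaces.linear_iff V.vector_space_axioms
          W.vector_space_axioms T.vector_space_axioms)
qed

theorem universal_property:
  assumes f: "bilinear_map sV sW sU f"
  shows "\<exists>!h. Vector_Spaces.linear (tscale T) sU h \<and> (\<forall>v w. h (tens T v w) = f v w)"
proof (rule ex_ex1I)
  let ?E = "free_extend (tscale T) (case_prod (tens T))"
  let ?F = "free_extend sU (case_prod f)"
  have U: "vector_space sU"
    using f by (auto simp: bilinear_map_def Vector_Spaces.linear_iff)
  interpret U: vector_space sU by fact
  interpret F: Vector_Spaces.linear free_scale sU ?F
    using U by (rule linear_free_extend)
  define h where "h t = ?F (inv ?E t)" for t
  have h: "h (?E x) = ?F x" for x
  proof -
    have "?E (inv ?E (?E x) - x) = 0"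
      by (simp add: E.diff surj_f_inv_f[OF onto])
    then have "?F (inv ?E (?E x) - x) = 0"
      using free_extend_relations[OF f] kernel by blast
    then show ?thesis by (simp add: h_def F.diff)
  qed
  have "h (s + t) = h s + h t" for s t
  proof -
    obtain x y where "s = ?E x" "t = ?E y" using onto by (metis surjD)
    then show ?thesis by (metis h E.add F.add)
  qed
  moreover have "h (tscale T c t) = sU c (h t)" for c t
  proof -
    obtain x where "t = ?E x" using onto by (metis surjD)
    then show ?thesis by (metis h E.scale F.scale)
  qed
  moreover have "h (tens T v w) = f v w" for v w
    using h[of "Poly_Mapping.single (v, w) 1"]
    by (simp add: free_extend_single U T.vector_space_axioms)
  ultimately show "\<exists>h. Vector_Spaces.linear (tscale T) sU h \<and> (\<forall>v w. h (tens T v w) = f v w)"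
    using U T.vector_space_axioms by (auto simp: Vector_Spaces.linear_iff)
next
  fix h h'
  assume h: "Vector_Spaces.linear (tscale T) sU h \<and> (\<forall>v w. h (tens T v w) = f v w)"
    and h': "Vector_Spaces.linear (tscale T) sU h' \<and> (\<forall>v w. h' (tens T v w) = f v w)"
  show "h = h'"
  proof
    fix t
    obtain x where t: "t = free_extend (tscale T) (case_prod (tens T)) x"
      using onto by (metis surjD)
    have eq: "h \<circ> case_prod (tens T) = h' \<circ> case_prod (tens T)"
      using h h' by (auto simp: fun_eq_iff)
    show "h t = h' t"
      unfolding t
      using linear_comp_free_extend[OF conjunct1[OF h], of "case_prod (tens T)" x]
        linear_comp_free_extend[OF conjunct1[OF h'], of "case_prod (tens T)" x] eq by simp
  qed
qed

end

text \<open>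
  The spaces \<open>A \<otimes> A\<close> (\<open>T2\<close>) and \<open>A \<otimes> A \<otimes> A\<close>.  The latter is one space
  which is simultaneously \<open>A \<otimes> (A \<otimes> A)\<close> (\<open>T12\<close>) and \<open>(A \<otimes> A) \<otimes> A\<close> (\<open>T21\<close>), according
  to the usual identification \<open>x \<otimes> (y \<otimes> z) = (x \<otimes> y) \<otimes> z\<close>.
\<close>

locale tensor_cube =
  T2: tensor_product sA sA T2 +
  T12: tensor_product sA "tscale T2" T12 +
  T21: tensor_product "tscale T2" sA T21
  for sA :: "'k::field_char_0 \<Rightarrow> 'a::ab_group_add \<Rightarrow> 'a"
    and T2 :: "('k, 'a, 'a, 'b::ab_group_add) tensor_space"
    and T12 :: "('k, 'a, 'b, 'c::ab_group_add) tensor_space"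
    and T21 :: "('k, 'b, 'a, 'c) tensor_space" +
  assumes same_scale: "tscale T12 = tscale T21"
    and assoc: "tens T12 x (tens T2 y z) = tens T21 (tens T2 x y) z"

definition twist :: "('k::field, 'a, 'a, 'b::ab_group_add) tensor_space \<Rightarrow> 'b \<Rightarrow> 'b" where
  "twist T2 = tensor_lift T2 (tscale T2) (\<lambda>x y. tens T2 y x)"

text \<open>The cyclic permutation \<open>x \<otimes> y \<otimes> z \<mapsto> z \<otimes> x \<otimes> y\<close>.\<close>

definition cyc ::
  "('k::field, 'a, 'b, 'c::ab_group_add) tensor_space \<Rightarrow> ('k, 'b, 'a, 'c) tensor_space \<Rightarrow> 'c \<Rightarrow> 'c" where
  "cyc T12 T21 = tensor_lift T21 (tscale T12) (\<lambda>t z. tens T12 z t)"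

section \<open>Infinitesimal Hom-bialgebras (\<open>\<epsilon>\<close>-Hom-bialgebras)\<close>

locale eps_Hom_bialgebra =
  tensor_cube sA T2 T12 T21
  for sA :: "'k::field_char_0 \<Rightarrow> 'a::ab_group_add \<Rightarrow> 'a"
    and T2 :: "('k, 'a, 'a, 'b::ab_group_add) tensor_space"
    and T12 :: "('k, 'a, 'b, 'c::ab_group_add) tensor_space"
    and T21 :: "('k, 'b, 'a, 'c) tensor_space" +
  fixes \<mu> :: "'b \<Rightarrow> 'a" and \<Delta> :: "'a \<Rightarrow> 'b" and \<alpha> :: "'a \<Rightarrow> 'a"
  assumes linear_mult: "Vector_Spaces.linear (tscale T2) sA \<mu>"
    and linear_comult: "Vector_Spaces.linear sA (tscale T2) \<Delta>"
    and linear_alpha: "Vector_Spaces.linear sA sA \<alpha>"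
    and mult_alpha: "\<alpha> \<circ> \<mu> = \<mu> \<circ> tensor_map T2 T2 \<alpha> \<alpha>"
    and Hom_assoc: "\<mu> \<circ> tensor_map T12 T2 \<alpha> \<mu> = \<mu> \<circ> tensor_map T21 T2 \<mu> \<alpha>"
    and comult_alpha: "tensor_map T2 T2 \<alpha> \<alpha> \<circ> \<Delta> = \<Delta> \<circ> \<alpha>"
    and Hom_coassoc: "tensor_map T2 T12 \<alpha> \<Delta> \<circ> \<Delta> = tensor_map T2 T21 \<Delta> \<alpha> \<circ> \<Delta>"
    and comult_mult:
      "\<Delta> \<circ> \<mu> = (tensor_map T21 T2 \<mu> \<alpha> \<circ> tensor_map T2 T12 \<alpha> \<Delta>)
             + (tensor_map T12 T2 \<alpha> \<mu> \<circ> tensor_map T2 T21 \<Delta> \<alpha>)"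

text \<open>\<open>[a, b]\<^sub>\<bullet>\<close> for \<open>a \<in> A\<close> and \<open>b \<in> A \<otimes> A\<close>.\<close>

definition bullet ::
  "('k::field, 'a, 'a, 'b::ab_group_add) tensor_space \<Rightarrow> ('b \<Rightarrow> 'a) \<Rightarrow> ('a \<Rightarrow> 'a) \<Rightarrow> 'a \<Rightarrow> 'b \<Rightarrow> 'b" where
  "bullet T2 \<mu> \<alpha> a = tensor_lift T2 (tscale T2)
     (\<lambda>b1 b2. tens T2 (\<mu> (tens T2 (\<alpha> a) b1)) (\<alpha> b2) - tens T2 (\<alpha> b1) (\<mu> (tens T2 b2 (\<alpha> a))))"

definition balanceator ::
  "('k::field, 'a, 'a, 'b::ab_group_add) tensor_space \<Rightarrow> ('b \<Rightarrow> 'a) \<Rightarrow> ('a \<Rightarrow> 'b) \<Rightarrow> ('a \<Rightarrow> 'a) \<Rightarrow>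
   'a \<Rightarrow> 'a \<Rightarrow> 'b" where
  "balanceator T2 \<mu> \<Delta> \<alpha> x y =
     bullet T2 \<mu> \<alpha> x ((twist T2 \<circ> \<Delta>) y) + twist T2 (bullet T2 \<mu> \<alpha> y ((twist T2 \<circ> \<Delta>) x))"

section \<open>Hom-Lie bialgebras\<close>

text \<open>
  Brackets are given, like \<open>\<mu>\<close> above, as linear maps \<open>br\<close> on \<open>L \<otimes> L\<close>, i.e. \<open>[x, y] = br (x \<otimes> y)\<close>.
\<close>

locale Hom_Lie_algebra =
  tensor_cube sL T2 T12 T21
  for sL :: "'k::field_char_0 \<Rightarrow> 'a::ab_group_add \<Rightarrow> 'a"
    and T2 :: "('k, 'a, 'a, 'b::ab_group_add) tensor_space"
    and T12 :: "('k, 'a, 'b, 'c::ab_group_add) tensor_space"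
    and T21 :: "('k, 'b, 'a, 'c) tensor_space" +
  fixes br :: "'b \<Rightarrow> 'a" and \<alpha> :: "'a \<Rightarrow> 'a"
  assumes linear_bracket: "Vector_Spaces.linear (tscale T2) sL br"
    and linear_alpha: "Vector_Spaces.linear sL sL \<alpha>"
    and antisymmetric: "br (tens T2 x y) = - br (tens T2 y x)"
    and bracket_alpha: "\<alpha> \<circ> br = br \<circ> tensor_map T2 T2 \<alpha> \<alpha>"
    and Hom_Jacobi:
      "br \<circ> tensor_map T21 T2 br \<alpha> \<circ> (id + cyc T12 T21 + (cyc T12 T21 \<circ> cyc T12 T21)) = 0"

locale Hom_Lie_coalgebra =
  tensor_cube sL T2 T12 T21
  for sL :: "'k::field_char_0 \<Rightarrow> 'a::ab_group_add \<Rightarrow> 'a"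
    and T2 :: "('k, 'a, 'a, 'b::ab_group_add) tensor_space"
    and T12 :: "('k, 'a, 'b, 'c::ab_group_add) tensor_space"
    and T21 :: "('k, 'b, 'a, 'c) tensor_space" +
  fixes \<delta> :: "'a \<Rightarrow> 'b" and \<alpha> :: "'a \<Rightarrow> 'a"
  assumes linear_cobracket: "Vector_Spaces.linear sL (tscale T2) \<delta>"
    and linear_alpha: "Vector_Spaces.linear sL sL \<alpha>"
    and cobracket_alpha: "\<delta> \<circ> \<alpha> = tensor_map T2 T2 \<alpha> \<alpha> \<circ> \<delta>"
    and co_antisymmetric: "twist T2 \<circ> \<delta> = - \<delta>"
    and Hom_co_Jacobi:
      "(id + cyc T12 T21 + (cyc T12 T21 \<circ> cyc T12 T21)) \<circ> tensor_map T2 T12 \<alpha> \<delta> \<circ> \<delta> = 0"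

definition ad ::
  "('k::field, 'a, 'a, 'b::ab_group_add) tensor_space \<Rightarrow> ('b \<Rightarrow> 'a) \<Rightarrow> ('a \<Rightarrow> 'a) \<Rightarrow> 'a \<Rightarrow> 'b \<Rightarrow> 'b" where
  "ad T2 br \<alpha> x = tensor_lift T2 (tscale T2)
     (\<lambda>y1 y2. tens T2 (br (tens T2 x y1)) (\<alpha> y2) + tens T2 (\<alpha> y1) (br (tens T2 x y2)))"

locale Hom_Lie_bialgebra =
  Hom_Lie_algebra sL T2 T12 T21 br \<alpha> + Hom_Lie_coalgebra sL T2 T12 T21 \<delta> \<alpha>
  for sL :: "'k::field_char_0 \<Rightarrow> 'a::ab_group_add \<Rightarrow> 'a"
    and T2 :: "('k, 'a, 'a, 'b::ab_group_add) tensor_space"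
    and T12 :: "('k, 'a, 'b, 'c::ab_group_add) tensor_space"
    and T21 :: "('k, 'b, 'a, 'c) tensor_space"
    and br :: "'b \<Rightarrow> 'a" and \<delta> :: "'a \<Rightarrow> 'b" and \<alpha> :: "'a \<Rightarrow> 'a" +
  assumes compatible:
    "\<delta> (br (tens T2 x y)) = ad T2 br \<alpha> (\<alpha> x) (\<delta> y) - ad T2 br \<alpha> (\<alpha> y) (\<delta> x)"

end

theory Submission
  imports Defs
begin

text \<open>
  Put \<open>P\<^sub>x = [x, -]\<^sub>\<bullet>\<close>.  The compatibility of \<open>\<mu>\<close> and \<open>\<Delta>\<close> gives
  \<open>\<Delta>[x, y] = P\<^sub>x \<Delta>(y) - P\<^sub>y \<Delta>(x)\<close>, and expanding the commutator gives
  \<open>ad\<^bsub>\<alpha>(x)\<^esub> = P\<^sub>x + \<tau> P\<^sub>x \<tau>\<close>, hence \<open>ad\<^bsub>\<alpha>(x)\<^esub> (Id - \<tau>) = (Id - \<tau>) P\<^sub>x (Id - \<tau>)\<close>.  Therefore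
  \<open>\<delta>[x, y] - ad\<^bsub>\<alpha>(x)\<^esub> \<delta>(y) + ad\<^bsub>\<alpha>(y)\<^esub> \<delta>(x) = (Id - \<tau>) P\<^sub>x \<tau> \<Delta>(y) - (Id - \<tau>) P\<^sub>y \<tau> \<Delta>(x) = B(x, y) - B(y, x)\<close>.
  The Hom-Lie algebra and Hom-Lie coalgebra axioms always hold.  For the co-Jacobi identity, let
  \<open>t = (\<alpha> \<otimes> \<Delta>) \<Delta>(x) = (\<Delta> \<otimes> \<alpha>) \<Delta>(x)\<close> and let \<open>\<tau>'\<close> be the twist of the last two factors; then
  \<open>(\<alpha> \<otimes> \<delta>) \<delta>(x) = (Id - \<tau>') (Id - \<sigma>) t\<close>, which \<open>Id + \<sigma> + \<sigma>\<^sup>2\<close> annihilates because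
  \<open>\<sigma>\<^sup>3 = Id\<close> and \<open>\<tau>' \<sigma> = \<sigma>\<^sup>2 \<tau>'\<close>.
\<close>

section \<open>Linear maps on tensor products\<close>

lemma linear_zero_fun:
  assumes "vector_space s" "vector_space s'"
  shows "Vector_Spaces.linear s s' 0"
proof -
  interpret s': vector_space s' by fact
  show ?thesis
    using assms by (simp add: Vector_Spaces.linear_iff)
qed

lemma linear_id_fun: "vector_space s \<Longrightarrow> Vector_Spaces.linear s s id"
  by (simp add: Vector_Spaces.linear_iff)

lemma linear_plus:
  assumes "Vector_Spaces.linear s s' f" "Vector_Spaces.linear s s' g"
  shows "Vector_Spaces.linear s s' (f + g)"
proof -
  interpret f: Vector_Spaces.linear s s' f by fact
  show ?thesis
    using assms by (simp add: Vector_Spaces.linear_iff f.vs2.scale_right_distrib)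
qed

lemma linear_minus:
  assumes "Vector_Spaces.linear s s' f" "Vector_Spaces.linear s s' g"
  shows "Vector_Spaces.linear s s' (f - g)"
proof -
  interpret f: Vector_Spaces.linear s s' f by fact
  show ?thesis
    using assms by (simp add: Vector_Spaces.linear_iff f.vs2.scale_right_diff_distrib)
qed

lemmas linear_intros = Vector_Spaces.linear_compose linear_plus linear_minus linear_id_fun linear_zero_fun

lemma linear_apply_diff:
  assumes "Vector_Spaces.linear s s' f"
  shows "f (x - y) = f x - f y"
proof -
  interpret Vector_Spaces.linear s s' f by fact
  show ?thesis by (rule diff)
qed

lemma linear_apply_add:
  "Vector_Spaces.linear s s' f \<Longrightarrow> f (x + y) = f x + f y"
  by (simp add: Vector_Spaces.linear_iff)

context tensor_product
begin

lemma linear_tens: "Vector_Spaces.linear sW (tscale T) (tens T v)"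
  and linear_tens_left: "Vector_Spaces.linear sV (tscale T) (\<lambda>v. tens T v w)"
  using bilinear_tens by (auto simp: bilinear_map_def)

lemmas tens_diff = linear_apply_diff[OF linear_tens] linear_apply_diff[OF linear_tens_left]

lemma
  assumes "bilinear_map sV sW sU f"
  shows linear_tensor_lift: "Vector_Spaces.linear (tscale T) sU (tensor_lift T sU f)"
    and tensor_lift_tens: "tensor_lift T sU f (tens T v w) = f v w"
proof -
  note * = theI'[OF universal_property[OF assms], folded tensor_lift_def]
  from conjunct1[OF *] show "Vector_Spaces.linear (tscale T) sU (tensor_lift T sU f)" .
  from conjunct2[OF *] show "tensor_lift T sU f (tens T v w) = f v w" by blast
qed

text \<open>\<open>h\<close> and \<open>h'\<close> are both induced by the bilinear map
  \<open>\<lambda>v w. h (tens T v w)\<close>, so uniqueness in the universal property identifies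
  them.\<close>

lemma tensor_ext:
  assumes h: "Vector_Spaces.linear (tscale T) sU h" and h': "Vector_Spaces.linear (tscale T) sU h'"
    and eq: "\<And>v w. h (tens T v w) = h' (tens T v w)"
  shows "h = h'"
proof -
  have "Vector_Spaces.linear sW sU (h \<circ> tens T v)" for v
    using linear_tens h by (rule Vector_Spaces.linear_compose)
  moreover have "Vector_Spaces.linear sV sU (h \<circ> (\<lambda>v. tens T v w))" for w
    using linear_tens_left h by (rule Vector_Spaces.linear_compose)
  ultimately have "bilinear_map sV sW sU (\<lambda>v w. h (tens T v w))"
    by (simp add: bilinear_map_def comp_def)
  from universal_property[OF this] show ?thesis
    by (rule ex1E) (metis h h' eq)
qed

text \<open>Evaluates a lift whose formula is already known to come from a linear map, so
  bilinearity of that formula need not be checked by hand; applied below to \<open>bullet\<close>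
  and \<open>ad\<close>.\<close>

lemma tensor_lift_restrict:
  assumes "Vector_Spaces.linear (tscale T) sU h"
  shows "tensor_lift T sU (\<lambda>y z. h (tens T y z)) = h"
  unfolding tensor_lift_def
  using assms by (intro the_equality) (auto intro: tensor_ext)

end

lemma
  assumes T: "tensor_product sV sW T" and U: "tensor_product sX sY U"
    and f: "Vector_Spaces.linear sV sX f" and g: "Vector_Spaces.linear sW sY g"
  shows linear_tensor_map: "Vector_Spaces.linear (tscale T) (tscale U) (tensor_map T U f g)"
    and tensor_map_tens: "tensor_map T U f g (tens T v w) = tens U (f v) (g w)"
proof -
  interpret T: tensor_product sV sW T by fact
  interpret U: tensor_product sX sY U by fact
  have "Vector_Spaces.linear sW (tscale U) (tens U (f v) \<circ> g)" for v
    using g U.linear_tens by (rule Vector_Spaces.linear_compose)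
  moreover have "Vector_Spaces.linear sV (tscale U) ((\<lambda>x. tens U x (g w)) \<circ> f)" for w
    using f U.linear_tens_left by (rule Vector_Spaces.linear_compose)
  ultimately have b: "bilinear_map sV sW (tscale U) (\<lambda>v w. tens U (f v) (g w))"
    by (simp add: bilinear_map_def comp_def)
  show "Vector_Spaces.linear (tscale T) (tscale U) (tensor_map T U f g)"
    "tensor_map T U f g (tens T v w) = tens U (f v) (g w)"
    unfolding tensor_map_def by (fact T.linear_tensor_lift[OF b] T.tensor_lift_tens[OF b])+
qed

section \<open>Permutations of tensor factors\<close>

context tensor_cube
begin

lemmas tensor_products =
  T2.tensor_product_axioms T12.tensor_product_axioms T21.tensor_product_axioms

lemma bilinear_flip: "bilinear_map sA sA (tscale T2) (\<lambda>x y. tens T2 y x)"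
  using T2.bilinear_tens by (simp add: bilinear_map_def)

lemma linear_twist: "Vector_Spaces.linear (tscale T2) (tscale T2) (twist T2)"
  and twist_tens [simp]: "twist T2 (tens T2 x y) = tens T2 y x"
  unfolding twist_def
  using T2.linear_tensor_lift[OF bilinear_flip] T2.tensor_lift_tens[OF bilinear_flip] by auto

lemma twist_twist [simp]: "twist T2 (twist T2 u) = u"
proof -
  have "twist T2 \<circ> twist T2 = id"
    by (rule T2.tensor_ext)
       (auto intro!: linear_intros linear_twist T2.T.vector_space_axioms)
  then show ?thesis by (simp add: fun_eq_iff)
qed

lemma bilinear_rotate: "bilinear_map (tscale T2) sA (tscale T12) (\<lambda>t z. tens T12 z t)"
  using T12.bilinear_tens by (simp add: bilinear_map_def)

lemma linear_cyc: "Vector_Spaces.linear (tscale T21) (tscale T21) (cyc T12 T21)"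
  and cyc_tens: "cyc T12 T21 (tens T21 t z) = tens T12 z t"
  unfolding cyc_def
  using T21.linear_tensor_lift[OF bilinear_rotate] T21.tensor_lift_tens[OF bilinear_rotate]
  by (auto simp: same_scale)

lemma cyc_pure: "cyc T12 T21 (tens T21 (tens T2 x y) z) = tens T21 (tens T2 z x) y"
  by (simp add: cyc_tens assoc)

text \<open>Extensionality on the outer tensor product, then on the inner one with the last factor
  fixed.\<close>

lemma cube_ext:
  assumes h: "Vector_Spaces.linear (tscale T21) sU h" and h': "Vector_Spaces.linear (tscale T21) sU h'"
    and eq: "\<And>x y z. h (tens T21 (tens T2 x y) z) = h' (tens T21 (tens T2 x y) z)"
  shows "h = h'"
proof (rule T21.tensor_ext[OF h h'])
  fix t z
  have "h \<circ> (\<lambda>t. tens T21 t z) = h' \<circ> (\<lambda>t. tens T21 t z)"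
    by (rule T2.tensor_ext) (auto intro!: linear_intros h h' T21.linear_tens_left eq)
  then show "h (tens T21 t z) = h' (tens T21 t z)"
    by (simp add: fun_eq_iff)
qed

lemma cyc_cyc_cyc: "cyc T12 T21 (cyc T12 T21 (cyc T12 T21 t)) = t"
proof -
  have "cyc T12 T21 \<circ> cyc T12 T21 \<circ> cyc T12 T21 = id"
    by (rule cube_ext)
       (auto intro!: linear_intros linear_cyc T21.T.vector_space_axioms simp: cyc_pure)
  then show ?thesis by (simp add: fun_eq_iff)
qed

text \<open>Built on \<open>T12\<close>, where the last two factors form a single tensor.\<close>

definition twist_right where
  "twist_right = tensor_map T12 T12 id (twist T2)"

lemma linear_twist_right: "Vector_Spaces.linear (tscale T21) (tscale T21) twist_right"
  and twist_right_tens: "twist_right (tens T12 x t) = tens T12 x (twist T2 t)"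
  unfolding twist_right_def
  using linear_tensor_map[of sA "tscale T2" T12 sA "tscale T2" T12 id "twist T2"]
    tensor_map_tens[of sA "tscale T2" T12 sA "tscale T2" T12 id "twist T2"]
  by (auto simp: tensor_products linear_twist linear_id_fun T2.V.vector_space_axioms same_scale)

lemma twist_right_pure: "twist_right (tens T21 (tens T2 x y) z) = tens T21 (tens T2 x z) y"
  by (metis assoc twist_right_tens twist_tens)

text \<open>The relation in the symmetric group on three letters by which a transposition conjugates
  a 3-cycle to its inverse, here its square.\<close>

lemma twist_right_cyc:
  "twist_right (cyc T12 T21 t) = cyc T12 T21 (cyc T12 T21 (twist_right t))"
proof -
  have "twist_right \<circ> cyc T12 T21 = cyc T12 T21 \<circ> cyc T12 T21 \<circ> twist_right"
    by (rule cube_ext)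
       (auto intro!: linear_intros linear_cyc linear_twist_right simp: cyc_pure twist_right_pure)
  then show ?thesis by (simp add: fun_eq_iff)
qed

end

section \<open>Commutator bracket and cocommutator cobracket\<close>

context eps_Hom_bialgebra
begin

abbreviation br where "br \<equiv> \<mu> \<circ> (id - twist T2)"
abbreviation cobr where "cobr \<equiv> (id - twist T2) \<circ> \<Delta>"

lemma linear_br: "Vector_Spaces.linear (tscale T2) sA br"
  by (rule linear_intros linear_mult linear_twist T2.T.vector_space_axioms)+

lemma linear_cobr: "Vector_Spaces.linear sA (tscale T2) cobr"
  by (rule linear_intros linear_comult linear_twist T2.T.vector_space_axioms)+

lemma br_tens: "br (tens T2 x y) = \<mu> (tens T2 x y) - \<mu> (tens T2 y x)"
  by (simp add: linear_apply_diff[OF linear_mult])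

lemmas linear_maps = linear_mult linear_comult linear_alpha linear_twist linear_br linear_cobr

lemmas tensor_map_simps =
  tensor_map_tens[OF T2.tensor_product_axioms T2.tensor_product_axioms linear_alpha linear_alpha]
  tensor_map_tens[OF T12.tensor_product_axioms T2.tensor_product_axioms linear_alpha linear_mult]
  tensor_map_tens[OF T21.tensor_product_axioms T2.tensor_product_axioms linear_mult linear_alpha]
  tensor_map_tens[OF T21.tensor_product_axioms T2.tensor_product_axioms linear_br linear_alpha]
  tensor_map_tens[OF T2.tensor_product_axioms T12.tensor_product_axioms linear_alpha linear_comult]
  tensor_map_tens[OF T2.tensor_product_axioms T12.tensor_product_axioms linear_alpha linear_cobr]
  tensor_map_tens[OF T2.tensor_product_axioms T21.tensor_product_axioms linear_comult linear_alpha]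

lemma Hom_assoc_tens:
  "\<mu> (tens T2 (\<alpha> x) (\<mu> (tens T2 y z))) = \<mu> (tens T2 (\<mu> (tens T2 x y)) (\<alpha> z))"
  using fun_cong[OF Hom_assoc, of "tens T12 x (tens T2 y z)"]
  \<comment> \<open>The left side is evaluated on the \<open>T12\<close> form first; only then does
    \<open>assoc\<close> rebracket the argument for the right side.\<close>
  by (simp add: tensor_map_simps) (simp add: assoc tensor_map_simps)

lemma twist_tensor_map_alpha:
  "twist T2 (tensor_map T2 T2 \<alpha> \<alpha> u) = tensor_map T2 T2 \<alpha> \<alpha> (twist T2 u)"
proof -
  have "twist T2 \<circ> tensor_map T2 T2 \<alpha> \<alpha> = tensor_map T2 T2 \<alpha> \<alpha> \<circ> twist T2"
    by (rule T2.tensor_ext)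
       (auto intro!: linear_intros linear_tensor_map tensor_products linear_maps simp: tensor_map_simps)
  then show ?thesis by (simp add: fun_eq_iff)
qed

lemma Hom_Lie_algebra_commutator: "Hom_Lie_algebra sA T2 T12 T21 br \<alpha>"
proof (intro Hom_Lie_algebra.intro Hom_Lie_algebra_axioms.intro tensor_cube_axioms)
  show "Vector_Spaces.linear (tscale T2) sA br" "Vector_Spaces.linear sA sA \<alpha>"
    by (fact linear_br linear_alpha)+
  show "br (tens T2 x y) = - br (tens T2 y x)" for x y
    unfolding br_tens by simp
  show "\<alpha> \<circ> br = br \<circ> tensor_map T2 T2 \<alpha> \<alpha>"
  proof
    fix u
    have "\<alpha> (\<mu> v) = \<mu> (tensor_map T2 T2 \<alpha> \<alpha> v)" for v
      using fun_cong[OF mult_alpha, of v] by simp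
    then show "(\<alpha> \<circ> br) u = (br \<circ> tensor_map T2 T2 \<alpha> \<alpha>) u"
      by (simp add: linear_apply_diff[OF linear_mult] linear_apply_diff[OF linear_alpha] twist_tensor_map_alpha)
  qed
  let ?m = "tensor_map T21 T2 br \<alpha>" and ?c = "cyc T12 T21"
  have m: "Vector_Spaces.linear (tscale T21) (tscale T2) ?m"
    by (rule linear_tensor_map tensor_products linear_maps)+
  show "br \<circ> ?m \<circ> (id + ?c + (?c \<circ> ?c)) = 0"
  proof (rule cube_ext)
    show "Vector_Spaces.linear (tscale T21) sA (br \<circ> ?m \<circ> (id + ?c + (?c \<circ> ?c)))"
      by (rule linear_intros linear_br m linear_cyc T21.T.vector_space_axioms)+
    show "Vector_Spaces.linear (tscale T21) sA 0"
      by (intro linear_zero_fun T21.T.vector_space_axioms T2.V.vector_space_axioms)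
    fix x y z
    \<comment> \<open>\<open>Hom_assoc_tens\<close> brings every product to left-bracketed form, so
      that terms can be compared syntactically.\<close>
    have *: "br (?m (tens T21 (tens T2 x y) z)) =
        \<mu> (tens T2 (\<mu> (tens T2 x y)) (\<alpha> z)) - \<mu> (tens T2 (\<mu> (tens T2 y x)) (\<alpha> z))
        - (\<mu> (tens T2 (\<mu> (tens T2 z x)) (\<alpha> y)) - \<mu> (tens T2 (\<mu> (tens T2 z y)) (\<alpha> x)))" for x y z
      unfolding tensor_map_simps br_tens
      by (simp add: T2.tens_diff linear_apply_diff[OF linear_mult] Hom_assoc_tens)
    have "(br \<circ> ?m \<circ> (id + ?c + (?c \<circ> ?c))) (tens T21 (tens T2 x y) z) =
        br (?m (tens T21 (tens T2 x y) z)) + br (?m (tens T21 (tens T2 z x) y))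
        + br (?m (tens T21 (tens T2 y z) x))"
      by (simp add: cyc_pure linear_apply_add[OF m] linear_apply_add[OF linear_mult]
          linear_apply_diff[OF linear_mult] linear_apply_add[OF linear_twist])
    \<comment> \<open>Twelve terms: each of the six orderings of the factors occurs twice, with
      opposite signs.\<close>
    also have "\<dots> = 0"
      unfolding * by simp
    finally show "(br \<circ> ?m \<circ> (id + ?c + (?c \<circ> ?c))) (tens T21 (tens T2 x y) z) =
        0 (tens T21 (tens T2 x y) z)" by simp
  qed
qed

lemma Hom_Lie_coalgebra_cocommutator: "Hom_Lie_coalgebra sA T2 T12 T21 cobr \<alpha>"
proof (intro Hom_Lie_coalgebra.intro Hom_Lie_coalgebra_axioms.intro tensor_cube_axioms)
  show "Vector_Spaces.linear sA (tscale T2) cobr" "Vector_Spaces.linear sA sA \<alpha>"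
    by (fact linear_cobr linear_alpha)+
  have aa: "Vector_Spaces.linear (tscale T2) (tscale T2) (tensor_map T2 T2 \<alpha> \<alpha>)"
    by (rule linear_tensor_map tensor_products linear_maps)+
  show "cobr \<circ> \<alpha> = tensor_map T2 T2 \<alpha> \<alpha> \<circ> cobr"
  proof
    fix x
    show "(cobr \<circ> \<alpha>) x = (tensor_map T2 T2 \<alpha> \<alpha> \<circ> cobr) x"
      using fun_cong[OF comult_alpha, of x]
      by (simp add: linear_apply_diff[OF aa] flip: twist_tensor_map_alpha)
  qed
  show "twist T2 \<circ> cobr = - cobr"
    by (simp add: fun_eq_iff linear_apply_diff[OF linear_twist])
  let ?c = "cyc T12 T21"
  let ?d = "tensor_map T2 T12 \<alpha> \<Delta>" and ?d' = "tensor_map T2 T21 \<Delta> \<alpha>"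
  have d: "Vector_Spaces.linear (tscale T2) (tscale T21) ?d"
    unfolding same_scale[symmetric] by (rule linear_tensor_map tensor_products linear_maps)+
  have d': "Vector_Spaces.linear (tscale T2) (tscale T21) ?d'"
    by (rule linear_tensor_map tensor_products linear_maps)+
  have "Vector_Spaces.linear (tscale T2) (tscale T21) (tensor_map T2 T12 \<alpha> cobr)"
    unfolding same_scale[symmetric] by (rule linear_tensor_map tensor_products linear_maps)+
  then have "tensor_map T2 T12 \<alpha> cobr = (id - twist_right) \<circ> ?d"
    by (rule T2.tensor_ext)
       (auto intro!: linear_intros linear_twist_right d T21.T.vector_space_axioms
         simp: tensor_map_simps twist_right_tens T12.tens_diff)
  then have cobr: "tensor_map T2 T12 \<alpha> cobr u = ?d u - twist_right (?d u)" for u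
    by simp
  \<comment> \<open>Both sides send u \<otimes> v to \<alpha>(v) \<otimes> \<Delta>(u). With
    \<open>Hom_coassoc\<close> this turns the twisted half of \<open>cobr x\<close> into
    \<open>?c t\<close>.\<close>
  have "?d \<circ> twist T2 = ?c \<circ> ?d'"
    by (rule T2.tensor_ext)
       (auto intro!: linear_intros linear_cyc linear_twist d d' simp: tensor_map_simps cyc_tens)
  then have twist: "?d (twist T2 u) = ?c (?d' u)" for u
    by (simp add: fun_eq_iff)
  show "(id + ?c + (?c \<circ> ?c)) \<circ> tensor_map T2 T12 \<alpha> cobr \<circ> cobr = 0"
  proof
    fix x
    define t where "t = ?d (\<Delta> x)"
    have "?d' (\<Delta> x) = t"
      using fun_cong[OF Hom_coassoc, of x] by (simp add: t_def)
    then have "tensor_map T2 T12 \<alpha> cobr (cobr x) = (t - ?c t) - twist_right (t - ?c t)"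
      by (simp add: cobr linear_apply_diff[OF d] twist t_def)
    \<comment> \<open>The sum telescopes on t - \<sigma> t and likewise on s - \<sigma>(\<sigma> s),
      where s is \<open>twist_right t\<close>.\<close>
    then show "((id + ?c + (?c \<circ> ?c)) \<circ> tensor_map T2 T12 \<alpha> cobr \<circ> cobr) x = 0 x"
      by (simp add: linear_apply_diff[OF linear_cyc] linear_apply_diff[OF linear_twist_right]
          twist_right_cyc cyc_cyc_cyc)
  qed
qed

section \<open>The balanceator\<close>

abbreviation bul where "bul \<equiv> bullet T2 \<mu> \<alpha>"

abbreviation twisted where "twisted h \<equiv> twist T2 \<circ> h \<circ> twist T2"

text \<open>The bullet routed through the triple tensor product: this makes linearity a matter of
  composition and has the shape of the two summands in \<open>comult_mult\<close>.\<close>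

definition bul_cube where
  "bul_cube x = (tensor_map T21 T2 \<mu> \<alpha> \<circ> tens T12 (\<alpha> x))
    - (tensor_map T12 T2 \<alpha> \<mu> \<circ> (\<lambda>b. tens T21 b (\<alpha> x)))"

lemma linear_bul_cube: "Vector_Spaces.linear (tscale T2) (tscale T2) (bul_cube x)"
proof -
  have 1: "Vector_Spaces.linear (tscale T21) (tscale T2) (tensor_map T21 T2 \<mu> \<alpha>)"
    by (rule linear_tensor_map tensor_products linear_maps)+
  have 2: "Vector_Spaces.linear (tscale T21) (tscale T2) (tensor_map T12 T2 \<alpha> \<mu>)"
    unfolding same_scale[symmetric] by (rule linear_tensor_map tensor_products linear_maps)+
  show ?thesis
    unfolding bul_cube_def
    by (intro linear_minus Vector_Spaces.linear_compose[OF _ 1]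
        Vector_Spaces.linear_compose[OF _ 2] T21.linear_tens_left T12.linear_tens[unfolded same_scale])
qed

lemma bul_cube_tens:
  "bul_cube x (tens T2 y z) =
     tens T2 (\<mu> (tens T2 (\<alpha> x) y)) (\<alpha> z) - tens T2 (\<alpha> y) (\<mu> (tens T2 z (\<alpha> x)))"
proof -
  have "bul_cube x (tens T2 y z) = tensor_map T21 T2 \<mu> \<alpha> (tens T21 (tens T2 (\<alpha> x) y) z)
      - tensor_map T12 T2 \<alpha> \<mu> (tens T12 y (tens T2 z (\<alpha> x)))"
    by (simp add: bul_cube_def assoc)
  then show ?thesis
    by (simp add: tensor_map_simps)
qed

lemma bul_eq: "bul x = bul_cube x"
  unfolding bullet_def using T2.tensor_lift_restrict[OF linear_bul_cube]
  by (simp add: bul_cube_tens)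

lemma linear_bul: "Vector_Spaces.linear (tscale T2) (tscale T2) (bul x)"
  unfolding bul_eq by (rule linear_bul_cube)

text \<open>The first summand of \<Delta>(xy) and the second summand of -\<Delta>(yx) form
  \<open>bul x (\<Delta> y)\<close>; the other two form \<open>- bul y (\<Delta> x)\<close>.\<close>

lemma comult_commutator:
  "\<Delta> (br (tens T2 x y)) = bul x (\<Delta> y) - bul y (\<Delta> x)"
proof -
  have "\<Delta> (\<mu> (tens T2 x y)) = tensor_map T21 T2 \<mu> \<alpha> (tens T12 (\<alpha> x) (\<Delta> y))
      + tensor_map T12 T2 \<alpha> \<mu> (tens T21 (\<Delta> x) (\<alpha> y))" for x y
    using fun_cong[OF comult_mult, of "tens T2 x y"] by (simp add: tensor_map_simps)
  then show ?thesis
    unfolding br_tens bul_eq bul_cube_def by (simp add: linear_apply_diff[OF linear_comult])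
qed

text \<open>Of the four products in the expanded commutators, \<alpha>(x) times the first factor and
  the second factor times \<alpha>(x) give \<open>bul x\<close>; conjugation by the twist gives the
  other two.\<close>

lemma ad_alpha: "ad T2 br \<alpha> (\<alpha> x) = bul x + twisted (bul x)"
proof -
  have "Vector_Spaces.linear (tscale T2) (tscale T2) (bul x + twisted (bul x))"
    by (rule linear_intros linear_bul linear_twist)+
  from T2.tensor_lift_restrict[OF this] show ?thesis
    unfolding ad_def br_tens
    by (simp add: bul_eq bul_cube_tens linear_apply_diff[OF linear_twist] T2.tens_diff algebra_simps)
qed

lemma cobracket_defect:
  "cobr (br (tens T2 x y)) - (ad T2 br \<alpha> (\<alpha> x) (cobr y) - ad T2 br \<alpha> (\<alpha> y) (cobr x))
    = balanceator T2 \<mu> \<Delta> \<alpha> x y - balanceator T2 \<mu> \<Delta> \<alpha> y x"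
  \<comment> \<open>Only this composition is opened, which exposes \<open>\<Delta> (br ...)\<close>
    for \<open>comult_commutator\<close> while \<open>br\<close> stays folded.\<close>
  unfolding comp_apply[of _ \<Delta> "br (tens T2 x y)"] comult_commutator ad_alpha balanceator_def
  by (simp add: linear_apply_diff[OF linear_twist] linear_apply_diff[OF linear_bul] algebra_simps)

end

theorem corollary6p4:
  fixes sA :: "'k::field_char_0 \<Rightarrow> 'a::ab_group_add \<Rightarrow> 'a"
    and T2 :: "('k, 'a, 'a, 'b::ab_group_add) tensor_space"
    and T12 :: "('k, 'a, 'b, 'c::ab_group_add) tensor_space"
    and T21 :: "('k, 'b, 'a, 'c) tensor_space"
    and \<mu> :: "'b \<Rightarrow> 'a" and \<Delta> :: "'a \<Rightarrow> 'b" and \<alpha> :: "'a \<Rightarrow> 'a"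
  assumes "eps_Hom_bialgebra sA T2 T12 T21 \<mu> \<Delta> \<alpha>"
  shows "Hom_Lie_bialgebra sA T2 T12 T21 (\<mu> \<circ> (id - twist T2)) ((id - twist T2) \<circ> \<Delta>) \<alpha>
    \<longleftrightarrow> (\<forall>x y. balanceator T2 \<mu> \<Delta> \<alpha> x y = balanceator T2 \<mu> \<Delta> \<alpha> y x)"
proof -
  interpret eps_Hom_bialgebra sA T2 T12 T21 \<mu> \<Delta> \<alpha> by fact
  have "Hom_Lie_bialgebra sA T2 T12 T21 br cobr \<alpha> \<longleftrightarrow>
      (\<forall>x y. cobr (br (tens T2 x y)) = ad T2 br \<alpha> (\<alpha> x) (cobr y) - ad T2 br \<alpha> (\<alpha> y) (cobr x))"
    \<comment> \<open>The algebra and coalgebra conjuncts are true, leaving just the compatibility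
      condition.\<close>
    using Hom_Lie_algebra_commutator Hom_Lie_coalgebra_cocommutator
    by (simp only: Hom_Lie_bialgebra_def Hom_Lie_bialgebra_axioms_def simp_thms)
  also have "\<dots> \<longleftrightarrow> (\<forall>x y. balanceator T2 \<mu> \<Delta> \<alpha> x y = balanceator T2 \<mu> \<Delta> \<alpha> y x)"
    using cobracket_defect by (metis eq_iff_diff_eq_0)
  finally show ?thesis .
qed

end
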